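(* Let $D=\frac d{dz}$, $M_0=(1-z)D-1$, $M_1=(1-2z)D^2-(3-z)D$, and $M_k=M_{k-1}D-M_{k-2}(D^2z-zD)$ for $k\ge2$. Then $M_k$ is a linear differential operator of order $k+1$ of the form $$M_k=m_{k,k}(z)D^{k+1}+m_{k,k-1}(z)D^k+\dots+m_{k,0}(z)D+m_{k,-1}(z)$$ with polynomials $m_{k,i}$, where $m_{0,-1}=-1$, $m_{0,0}=1-z$, $m_{1,-1}=0$, $m_{1,0}=z-3$, $m_{1,1}=1-2z$, and for $k\ge2$: $m_{k,-1}=0$; $m_{k,0}=-2z+3$ if $k$ is even and $m_{k,0}=z-3$ if $k$ is odd; $m_{k,i}=m_{k-1,i-1}+(i+1)m_{k-2,i}+(z-i-2)m_{k-2,i-1}-z\,m_{k-2,i-2}$ for $1\le i\le k-1$; $m_{k,k}=m_{k-1,k-1}-z\,m_{k-2,k-2}$; and $m_{k,i}=0$ for $i>k$. Moreover $m_{k,k}(z)=\ell_{k,k}(z)$ for all $k$, where $\ell_{0,0}=1-z$, $\ell_{1,1}=1-2z$, $\ell_{k,k}=\ell_{k-1,k-1}-z\ell_{k-2,k-2}$.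
   Context: Operators compose as products, $z$ acts by multiplication, $D^2z$ is $F\mapsto(zF)''$, $zD$ is $F\mapsto zF'$. In the recurrence, $m_{j,i}$ with $i>j$ or $i<-1$ is taken to be $0$. *)

theory Defs
  imports "HOL-Computational_Algebra.Computational_Algebra"
begin

text \<open>
  Operators are maps on formal power series over a field of characteristic zero, composed as
  functions. The algebra of differential operators with polynomial coefficients acts faithfully
  there, so an identity between such operators is the same as an identity between these maps.
\<close>

abbreviation zpoly :: "'a::comm_ring_1 poly" where
  "zpoly \<equiv> [:0, 1:]"

definition diff_op :: "nat \<Rightarrow> (nat \<Rightarrow> 'a::field_char_0 poly) \<Rightarrow> 'a fps \<Rightarrow> 'a fps" where
  "diff_op r a = (\<lambda>F. \<Sum>j\<le>r. fps_of_poly (a j) * (fps_deriv ^^ j) F)"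

definition is_diff_op_of_order :: "('a::field_char_0 fps \<Rightarrow> 'a fps) \<Rightarrow> nat \<Rightarrow> bool" where
  "is_diff_op_of_order L r \<longleftrightarrow> (\<exists>a. a r \<noteq> 0 \<and> L = diff_op r a)"

fun M :: "nat \<Rightarrow> 'a::field_char_0 fps \<Rightarrow> 'a fps" where
  "M 0 F = (1 - fps_X) * fps_deriv F - F"
| "M (Suc 0) F = (1 - 2 * fps_X) * fps_deriv (fps_deriv F) - (3 - fps_X) * fps_deriv F"
| "M (Suc (Suc k)) F =
     M (Suc k) (fps_deriv F) - M k (fps_deriv (fps_deriv (fps_X * F)) - fps_X * fps_deriv F)"

text \<open>Only the diagonal entries \<open>\<ell>\<^sub>k\<^sub>,\<^sub>k\<close> are defined.\<close>

fun ell_diag :: "nat \<Rightarrow> 'a::comm_ring_1 poly" where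
  "ell_diag 0 = 1 - zpoly"
| "ell_diag (Suc 0) = 1 - 2 * zpoly"
| "ell_diag (Suc (Suc k)) = ell_diag (Suc k) - zpoly * ell_diag k"

end

(* By the Leibniz rule, D^n (D^2 z - z D) = z D^(n+2) + (n + 2 - z) D^(n+1) - n D^n; comparing
   coefficients of D^(i+1) in the recursion for M_k gives one recurrence which, once m_{k,i} is
   extended by 0 outside -1 <= i <= k, holds for every integer i, and the special cases i = -1, 0, k
   follow from it. The diagonal polynomials take the value 1 at z = 0, so the order is exactly k + 1. *)
theory Submission
  imports Defs
begin

text \<open>The second index is an integer, so \<open>i - 1\<close> and \<open>i - 2\<close> are
  never truncated. The recursive clause has no bounds on \<open>i\<close>; vanishing outside the
  range -1 to k is proved in \<open>diff_coeff_eq_0\<close>.\<close>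

fun diff_coeff :: "nat \<Rightarrow> int \<Rightarrow> 'a::comm_ring_1 poly" where
  "diff_coeff 0 i = (if i = -1 then -1 else if i = 0 then 1 - zpoly else 0)"
| "diff_coeff (Suc 0) i = (if i = 0 then zpoly - 3 else if i = 1 then 1 - 2 * zpoly else 0)"
| diff_coeff_rec: "diff_coeff (Suc (Suc k)) i =
     diff_coeff (Suc k) (i - 1) + (of_int i + 1) * diff_coeff k i
     + (zpoly - of_int i - 2) * diff_coeff k (i - 1) - zpoly * diff_coeff k (i - 2)"

declare diff_coeff_rec [simp del]

lemma diff_coeff_eq_0: "i > int k \<or> i < -1 \<Longrightarrow> diff_coeff k i = 0"
  by (induction k i rule: diff_coeff.induct) (auto simp: diff_coeff_rec)

text \<open>At i = -1 the factor i + 1 vanishes, and the other three terms of the recurrence have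
  second index below -1.\<close>

lemma diff_coeff_minus_one: "k \<ge> 1 \<Longrightarrow> diff_coeff k (-1) = 0"
  by (induction k "-1 :: int" rule: diff_coeff.induct) (auto simp: diff_coeff_rec diff_coeff_eq_0)

text \<open>For k \<ge> 3 the recurrence at i = 0 retains only the entry at (k - 2, 0), because
  column -1 vanishes from row 1 on. Hence the column has period two.\<close>

lemma diff_coeff_zero:
  "k \<ge> 1 \<Longrightarrow>
     diff_coeff k 0 = (if even k then - 2 * zpoly + 3 else zpoly - 3 :: 'a::comm_ring_1 poly)"
proof (induction k rule: less_induct)
  case (less k)
  consider "k = 1" | "k = 2" | n where "k = Suc (Suc n)" "n \<ge> 1"
    using less.prems by (metis One_nat_def Suc_1 le_SucE le_add1 not0_implies_Suc not_one_le_zero plus_1_eq_Suc)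
  then show ?case
  proof cases
    case 1
    then show ?thesis by simp
  next
    case 2
    \<comment> \<open>Row 2 is separate since it sees the nonzero entry -1 at (0, -1): (1 - z) - (z
      - 2) = 3 - 2z.\<close>
    have "diff_coeff (Suc (Suc 0)) 0 = - 2 * zpoly + (3 :: 'a poly)"
      by (subst diff_coeff_rec) (simp add: numeral_poly one_pCons)
    with 2 show ?thesis by (simp add: numeral_2_eq_2)
  next
    case 3
    then show ?thesis
      using less.IH[of n] by (simp add: diff_coeff_rec diff_coeff_eq_0 diff_coeff_minus_one)
  qed
qed

text \<open>At i = k the two middle terms of the recurrence lie to the right of the diagonal in row
  k - 2.\<close>

lemma diff_coeff_diagonal: "diff_coeff k (int k) = (ell_diag k :: 'a::comm_ring_1 poly)"
proof (induction k rule: ell_diag.induct)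
  case (3 k)
  have "diff_coeff (Suc (Suc k)) (int (Suc (Suc k)))
          = diff_coeff (Suc k) (int (Suc k)) - zpoly * (diff_coeff k (int k) :: 'a poly)"
    by (subst diff_coeff_rec) (simp add: diff_coeff_eq_0)
  with 3 show ?case by simp
qed simp_all

lemma ell_diag_nonzero: "ell_diag k \<noteq> (0 :: 'a::comm_ring_1 poly)"
proof -
  have "poly (ell_diag k :: 'a poly) 0 = 1"
    by (induction k rule: ell_diag.induct) simp_all
  then show ?thesis by auto
qed

text \<open>Leibniz rule, cut off after two terms because the second derivative of
  \<open>fps_X\<close> is 0. For n = 0 the truncated \<open>n - 1\<close> is harmless, as its factor
  is 0.\<close>

lemma fps_deriv_funpow_X_mult:
  "(fps_deriv ^^ n) (fps_X * F)
     = fps_X * (fps_deriv ^^ n) F + of_nat n * (fps_deriv ^^ (n - 1)) (F :: 'a::comm_ring_1 fps)"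
proof (induction n)
  case (Suc n)
  then show ?case by (cases n) (simp_all add: algebra_simps)
qed simp

lemma fps_deriv_funpow_diff:
  "(fps_deriv ^^ n) (F - G) = (fps_deriv ^^ n) F - (fps_deriv ^^ n) (G :: 'a::comm_ring_1 fps)"
  by (induction n) simp_all

lemma fps_deriv_funpow_M_arg:
  fixes F :: "'a::comm_ring_1 fps"
  shows "(fps_deriv ^^ n) (fps_deriv (fps_deriv (fps_X * F)) - fps_X * fps_deriv F)
     = fps_X * (fps_deriv ^^ (n + 2)) F + (of_nat n + 2 - fps_X) * (fps_deriv ^^ (n + 1)) F
       - of_nat n * (fps_deriv ^^ n) F"
proof -
  \<comment> \<open>The outer derivatives join the power, with the product left intact, so that the
    Leibniz lemma applies once, with n + 2 in place of n.\<close>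
  have 1: "(fps_deriv ^^ n) (fps_deriv (fps_deriv (fps_X * F))) = (fps_deriv ^^ (n + 2)) (fps_X * F)"
    by (simp add: funpow_swap1 del: fps_deriv_mult)
  have 2: "of_nat n * (fps_deriv ^^ (n - 1)) (fps_deriv F) = of_nat n * (fps_deriv ^^ n) F"
    by (cases n) (simp_all add: funpow_swap1)
  show ?thesis
    unfolding fps_deriv_funpow_diff 1 fps_deriv_funpow_X_mult 2
    by (simp add: funpow_swap1 algebra_simps)
qed

lemma fps_of_poly_zpoly [simp]: "fps_of_poly zpoly = fps_X"
  by (simp add: fps_of_poly_pCons)

lemma fps_of_poly_of_nat [simp]: "fps_of_poly (of_nat n) = of_nat n"
  by (induction n) (simp_all add: fps_of_poly_add)

lemma diff_op_extend:
  assumes "r \<le> s" "\<And>j. r < j \<Longrightarrow> a j = 0"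
  shows "diff_op r a F = diff_op s a F"
  unfolding diff_op_def using assms by (intro sum.mono_neutral_left) auto

text \<open>Splits off a right factor D; this turns the shifted indices i - 1 and i - 2 of the
  recurrence into derivatives of the argument.\<close>

lemma diff_op_shift:
  assumes "b 0 = 0"
  shows "diff_op (Suc r) b F = diff_op r (\<lambda>j. b (Suc j)) (fps_deriv F)"
  unfolding diff_op_def sum.atMost_Suc_shift using assms by (simp add: funpow_swap1)

lemma diff_op_diff_coeff_rec:
  fixes F :: "'a::field_char_0 fps"
  defines "c \<equiv> \<lambda>k j. diff_coeff k (int j - 1) :: 'a poly"
  shows "diff_op (k + 3) (c (k + 2)) F
     = diff_op (k + 2) (c (k + 1)) (fps_deriv F)
       - diff_op (k + 1) (c k) (fps_deriv (fps_deriv (fps_X * F)) - fps_X * fps_deriv F)"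
proof -
  \<comment> \<open>With i = j - 1, these are the four terms of the recurrence as coefficients of
    D^j: \<open>b1\<close> comes from M_(k+1) D, and \<open>b2\<close>, \<open>b3\<close>,
    \<open>b4\<close> from the terms in D^n, D^(n+1), D^(n+2) of the Leibniz expansion.\<close>
  define b1 where "b1 = (\<lambda>j. diff_coeff (k + 1) (int j - 2) :: 'a poly)"
  define b2 where "b2 = (\<lambda>j. of_nat j * c k j)"
  define b3 where "b3 = (\<lambda>j. (zpoly - of_nat j - 1) * (diff_coeff k (int j - 2) :: 'a poly))"
  define b4 where "b4 = (\<lambda>j. zpoly * (diff_coeff k (int j - 3) :: 'a poly))"
  have rec: "c (k + 2) j = b1 j + b2 j + b3 j - b4 j" for j
    by (simp add: c_def b1_def b2_def b3_def b4_def diff_coeff_rec)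
  have "diff_op (k + 3) (c (k + 2)) F
      = diff_op (k + 3) b1 F + diff_op (k + 3) b2 F + diff_op (k + 3) b3 F - diff_op (k + 3) b4 F"
    unfolding diff_op_def rec
    by (simp add: fps_of_poly_add fps_of_poly_diff algebra_simps sum.distrib sum_subtractf)
  moreover have "diff_op (k + 3) b1 F = diff_op (k + 2) (c (k + 1)) (fps_deriv F)"
    using diff_op_shift[of b1 "k + 2" F]
    by (simp add: b1_def c_def diff_coeff_eq_0 numeral_3_eq_3)
  \<comment> \<open>The last three sums are brought to the bound k + 1 of M_k: \<open>b2\<close>
    loses two zero top terms, \<open>b3\<close> loses one and is shifted once, \<open>b4\<close> is
    shifted twice.\<close>
  moreover have "diff_op (k + 3) b2 F = diff_op (k + 1) b2 F"
    by (rule diff_op_extend[symmetric]) (auto simp: b2_def c_def diff_coeff_eq_0)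
  moreover have "diff_op (k + 3) b3 F
      = diff_op (k + 1) (\<lambda>j. (zpoly - of_nat j - 2) * c k j) (fps_deriv F)"
  proof -
    have "diff_op (k + 3) b3 F = diff_op (Suc (k + 1)) b3 F"
      by (rule diff_op_extend[symmetric]) (auto simp: b3_def diff_coeff_eq_0)
    also have "\<dots> = diff_op (k + 1) (\<lambda>j. b3 (Suc j)) (fps_deriv F)"
      by (rule diff_op_shift) (simp add: b3_def diff_coeff_eq_0)
    also have "(\<lambda>j. b3 (Suc j)) = (\<lambda>j. (zpoly - of_nat j - 2) * c k j)"
      by (simp add: fun_eq_iff b3_def c_def algebra_simps)
    finally show ?thesis .
  qed
  moreover have "diff_op (k + 3) b4 F
      = diff_op (k + 1) (\<lambda>j. zpoly * c k j) (fps_deriv (fps_deriv F))"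
  proof -
    have "diff_op (Suc (Suc (k + 1))) b4 F
        = diff_op (Suc (k + 1)) (\<lambda>j. b4 (Suc j)) (fps_deriv F)"
      by (rule diff_op_shift) (simp add: b4_def diff_coeff_eq_0)
    also have "\<dots> = diff_op (k + 1) (\<lambda>j. b4 (Suc (Suc j))) (fps_deriv (fps_deriv F))"
      by (rule diff_op_shift) (simp add: b4_def diff_coeff_eq_0)
    finally show ?thesis by (simp add: b4_def c_def numeral_3_eq_3)
  qed
  \<comment> \<open>The Leibniz expansion is inserted term by term with n = j, so each coefficient
    \<open>c k j\<close> splits over three derivatives.\<close>
  moreover have "diff_op (k + 1) (c k) (fps_deriv (fps_deriv (fps_X * F)) - fps_X * fps_deriv F)
      = diff_op (k + 1) (\<lambda>j. zpoly * c k j) (fps_deriv (fps_deriv F))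
        - diff_op (k + 1) (\<lambda>j. (zpoly - of_nat j - 2) * c k j) (fps_deriv F)
        - diff_op (k + 1) b2 F"
    unfolding diff_op_def fps_deriv_funpow_M_arg sum_subtractf[symmetric]
    by (intro sum.cong refl)
       (simp add: b2_def fps_of_poly_mult fps_of_poly_diff fps_of_poly_add fps_of_poly_pCons
          funpow_swap1 algebra_simps)
  ultimately show ?thesis by simp
qed

lemma M_eq_diff_op: "M k F = diff_op (k + 1) (\<lambda>j. diff_coeff k (int j - 1)) F"
proof (induction k F rule: M.induct)
  case (1 F)
  then show ?case by (simp add: diff_op_def fps_of_poly_diff fps_of_poly_uminus)
next
  case (2 F)
  have "fps_of_poly (2 * zpoly) = (2 * fps_X :: 'a fps)"
    unfolding fps_of_poly_mult by simp
  then show ?case by (simp add: diff_op_def fps_of_poly_diff numeral_2_eq_2 algebra_simps)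
next
  case (3 k F)
  then show ?case using diff_op_diff_coeff_rec[of k F] by (simp add: numeral_3_eq_3)
qed

theorem mainTheorem18:
  "\<exists>m :: nat \<Rightarrow> int \<Rightarrow> 'a::field_char_0 poly.
     (\<forall>k. is_diff_op_of_order (M k :: 'a fps \<Rightarrow> 'a fps) (k + 1)) \<and>
     (\<forall>k. M k = diff_op (k + 1) (\<lambda>j. m k (int j - 1))) \<and>
     (\<forall>k i. i > int k \<or> i < -1 \<longrightarrow> m k i = 0) \<and>
     m 0 (-1) = -1 \<and> m 0 0 = 1 - zpoly \<and>
     m 1 (-1) = 0 \<and> m 1 0 = zpoly - 3 \<and> m 1 1 = 1 - 2 * zpoly \<and>
     (\<forall>k\<ge>2.
        m k (-1) = 0 \<and>
        m k 0 = (if even k then - 2 * zpoly + 3 else zpoly - 3) \<and>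
        (\<forall>i. 1 \<le> i \<and> i \<le> int k - 1 \<longrightarrow>
           m k i = m (k - 1) (i - 1) + (of_int i + 1) * m (k - 2) i
                   + (zpoly - of_int i - 2) * m (k - 2) (i - 1)
                   - zpoly * m (k - 2) (i - 2)) \<and>
        m k (int k) = m (k - 1) (int k - 1) - zpoly * m (k - 2) (int k - 2)) \<and>
     (\<forall>k. m k (int k) = ell_diag k)"
proof (intro exI[of _ diff_coeff] conjI allI impI)
  fix k :: nat
  show M: "M k = (diff_op (k + 1) (\<lambda>j. diff_coeff k (int j - 1)) :: 'a fps \<Rightarrow> 'a fps)"
    by (rule ext) (rule M_eq_diff_op)
  show "is_diff_op_of_order (M k :: 'a fps \<Rightarrow> 'a fps) (k + 1)"
    \<comment> \<open>The top coefficient, at j = k + 1, is the diagonal entry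
      \<open>ell_diag k\<close>, which is nonzero.\<close>
    unfolding is_diff_op_of_order_def using M
    by (intro exI[of _ "\<lambda>j. diff_coeff k (int j - 1)"])
       (simp add: diff_coeff_diagonal ell_diag_nonzero)
  show "diff_coeff k (int k) = (ell_diag k :: 'a poly)"
    by (rule diff_coeff_diagonal)
next
  fix k :: nat and i :: int
  assume "i > int k \<or> i < -1"
  then show "diff_coeff k i = (0 :: 'a poly)" by (rule diff_coeff_eq_0)
next
  fix k :: nat
  assume "k \<ge> 2"
  then obtain n where k: "k = Suc (Suc n)"
    using that[of "k - 2"] by simp
  show "diff_coeff k (-1) = (0 :: 'a poly)"
    using k by (simp add: diff_coeff_minus_one)
  show "diff_coeff k 0 = (if even k then - 2 * zpoly + 3 else zpoly - 3 :: 'a poly)"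
    using k by (intro diff_coeff_zero) simp
  show "diff_coeff k i = diff_coeff (k - 1) (i - 1) + (of_int i + 1) * diff_coeff (k - 2) i
          + (zpoly - of_int i - 2) * diff_coeff (k - 2) (i - 1)
          - zpoly * (diff_coeff (k - 2) (i - 2) :: 'a poly)" for i
    by (simp add: k diff_coeff_rec)
  show "diff_coeff k (int k)
      = diff_coeff (k - 1) (int k - 1) - zpoly * (diff_coeff (k - 2) (int k - 2) :: 'a poly)"
    by (simp add: k diff_coeff_rec diff_coeff_eq_0)
\<comment> \<open>What remains are the initial values for k = 0 and k = 1.\<close>
qed (simp_all only: One_nat_def diff_coeff.simps rel_simps if_True if_False simp_thms)

end
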